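(* Let $S$ be a stable semigroup, let $U$ be a regular subsemigroup of $S$, and let $x, y \in U$ with $x \mathrel{\mathcal{J}} y$ (in $S$) and $x \leq_{\mathcal{J}'} y$ (in $U$). Then $x \mathrel{\mathcal{D}'} y$ (in $U$).
   Context: For a semigroup $T$, $T^1$ denotes $T$ if $T$ is a monoid, and otherwise $T$ with an identity adjoined. Green's pre-orders on $T$: $x \leq_{\mathcal{R}} y \iff x \in yT^1$; $x \leq_{\mathcal{L}} y \iff x \in T^1y$; $x \leq_{\mathcal{J}} y \iff x \in T^1yT^1$. Green's relations $\mathcal{R}, \mathcal{L}, \mathcal{J}$ are the equivalences induced by these pre-orders; $\mathcal{D} = \mathcal{R} \circ \mathcal{L} = \mathcal{L} \circ \mathcal{R}$. If $U$ is a subsemigroup of $S$, unprimed symbols denote the relations on $S$, and primed symbols $\mathcal{G}'$, $\leq_{\mathcal{G}'}$ denote the corresponding relations on the semigroup $U$ (computed with multipliers in $U^1$). A subsemigroup $U$ is regular if it is regular as a semigroup: for every $y \in U$ there is $z \in U$ with $y = yzy$. A semigroup $S$ is right-stable if for all $x, y \in S$, $x \mathrel{\mathcal{J}} xy \Rightarrow x \mathrel{\mathcal{R}} xy$; left-stable if for all $x, y \in S$, $x \mathrel{\mathcal{J}} yx \Rightarrow x \mathrel{\mathcal{L}} yx$; and stable if it is both left- and right-stable. *)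

theory Defs
  imports Main
begin

text \<open>
  Ambient semigroups are types of class \<open>semigroup_mult\<close>. All notions below are relative to a
  multiplicatively closed set \<open>T\<close>, regarded as a semigroup in its own right, so that they apply
  to the whole semigroup (\<open>T = UNIV\<close>) and to its subsemigroups alike.
\<close>

definition subsemigroup :: "'a::semigroup_mult set \<Rightarrow> bool" where
  "subsemigroup T \<longleftrightarrow> (\<forall>x\<in>T. \<forall>y\<in>T. x * y \<in> T)"

definition has_identity :: "'a::semigroup_mult set \<Rightarrow> bool" where
  "has_identity T \<longleftrightarrow> (\<exists>e\<in>T. \<forall>x\<in>T. e * x = x \<and> x * e = x)"

text \<open>
  \<open>T\<^sup>1\<close> lives in the option type: \<open>Some\<close> embeds \<open>T\<close>, and \<open>None\<close> is the adjoined identity, present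
  only if \<open>T\<close> has none of its own. In particular the identity of the ambient semigroup, if it lies
  outside \<open>T\<close>, plays no role.
\<close>

definition adjoin_identity :: "'a::semigroup_mult set \<Rightarrow> 'a option set" where
  "adjoin_identity T = (if has_identity T then Some ` T else insert None (Some ` T))"

fun mult1 :: "'a::semigroup_mult option \<Rightarrow> 'a option \<Rightarrow> 'a option" (infixl "\<odot>" 70) where
  "Some x \<odot> Some y = Some (x * y)"
| "None \<odot> t = t"
| "s \<odot> None = s"

definition le_R :: "'a::semigroup_mult set \<Rightarrow> 'a rel" where
  "le_R T = {(x, y). x \<in> T \<and> y \<in> T \<and> Some x \<in> {Some y \<odot> t | t. t \<in> adjoin_identity T}}"

definition le_L :: "'a::semigroup_mult set \<Rightarrow> 'a rel" where
  "le_L T = {(x, y). x \<in> T \<and> y \<in> T \<and> Some x \<in> {s \<odot> Some y | s. s \<in> adjoin_identity T}}"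

definition le_J :: "'a::semigroup_mult set \<Rightarrow> 'a rel" where
  "le_J T = {(x, y). x \<in> T \<and> y \<in> T \<and>
     Some x \<in> {s \<odot> Some y \<odot> t | s t. s \<in> adjoin_identity T \<and> t \<in> adjoin_identity T}}"

definition green_R :: "'a::semigroup_mult set \<Rightarrow> 'a rel" where
  "green_R T = le_R T \<inter> (le_R T)\<inverse>"

definition green_L :: "'a::semigroup_mult set \<Rightarrow> 'a rel" where
  "green_L T = le_L T \<inter> (le_L T)\<inverse>"

definition green_J :: "'a::semigroup_mult set \<Rightarrow> 'a rel" where
  "green_J T = le_J T \<inter> (le_J T)\<inverse>"

definition green_D :: "'a::semigroup_mult set \<Rightarrow> 'a rel" where
  "green_D T = green_R T O green_L T"

definition regular_semigroup :: "'a::semigroup_mult set \<Rightarrow> bool" where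
  "regular_semigroup T \<longleftrightarrow> (\<forall>y\<in>T. \<exists>z\<in>T. y = y * z * y)"

definition right_stable :: "'a::semigroup_mult set \<Rightarrow> bool" where
  "right_stable T \<longleftrightarrow> (\<forall>x\<in>T. \<forall>y\<in>T. (x, x * y) \<in> green_J T \<longrightarrow> (x, x * y) \<in> green_R T)"

definition left_stable :: "'a::semigroup_mult set \<Rightarrow> bool" where
  "left_stable T \<longleftrightarrow> (\<forall>x\<in>T. \<forall>y\<in>T. (x, y * x) \<in> green_J T \<longrightarrow> (x, y * x) \<in> green_L T)"

definition stable_semigroup :: "'a::semigroup_mult set \<Rightarrow> bool" where
  "stable_semigroup T \<longleftrightarrow> left_stable T \<and> right_stable T"

end

theory Submission
  imports Defs
begin

text \<open>
  Regularity of \<open>U\<close> enters twice. First, \<open>y = y z y\<close> lets every multiplier in \<open>U\<^sup>1\<close> be replaced by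
  one in \<open>U\<close> itself, so that \<open>x = a y b\<close> with \<open>a, b \<in> U\<close> (lemma \<open>le_J_regularE\<close>). In \<open>S\<close>, the
  elements \<open>y\<close>, \<open>a y\<close> and \<open>a y b = x\<close> form a descending \<open>\<J>\<close>-chain whose ends are \<open>\<J>\<close>-related, so
  all three are \<open>\<J>\<close>-related; stability upgrades the two steps to \<open>y \<L> a y\<close> and \<open>a y \<R> x\<close> in \<open>S\<close>.
  Secondly, on a regular subsemigroup the pre-orders \<open>\<le>\<^sub>\<L>\<close> and \<open>\<le>\<^sub>\<R>\<close> agree with those of the
  ambient semigroup (lemmas \<open>le_L_restrict_regular\<close> and \<open>le_R_restrict_regular\<close>). As \<open>a y \<in> U\<close>,
  both relations therefore hold in \<open>U\<close>, and \<open>a y\<close> witnesses \<open>x \<D> y\<close> there.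
\<close>

text \<open>
  When \<open>T\<close> is a monoid, nothing is adjoined, but multiplication by the identity of \<open>T\<close> covers the
  cases in which a factor is absent. The pre-orders can thus be described by factors that are absent
  or lie in \<open>T\<close>, by the same formula whether or not \<open>T\<close> has an identity.
\<close>

lemma le_R_iff:
  "(x, y) \<in> le_R T \<longleftrightarrow> x \<in> T \<and> y \<in> T \<and> (x = y \<or> (\<exists>b\<in>T. x = y * b))"
proof (cases "has_identity T")
  case True
  then obtain e where e: "e \<in> T" "\<And>z. z \<in> T \<Longrightarrow> e * z = z \<and> z * e = z"
    unfolding has_identity_def by blast
  have "(x, y) \<in> le_R T \<longleftrightarrow> x \<in> T \<and> y \<in> T \<and> (\<exists>b\<in>T. x = y * b)"
    using True unfolding le_R_def adjoin_identity_def by (auto simp: split_option_ex)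
  moreover have "(\<exists>b\<in>T. x = y * b)" if "x = y" "y \<in> T"
    using that e by metis
  ultimately show ?thesis by blast
next
  case False
  then show ?thesis unfolding le_R_def adjoin_identity_def by (auto simp: split_option_ex)
qed

lemma le_L_iff:
  "(x, y) \<in> le_L T \<longleftrightarrow> x \<in> T \<and> y \<in> T \<and> (x = y \<or> (\<exists>a\<in>T. x = a * y))"
proof (cases "has_identity T")
  case True
  then obtain e where e: "e \<in> T" "\<And>z. z \<in> T \<Longrightarrow> e * z = z \<and> z * e = z"
    unfolding has_identity_def by blast
  have "(x, y) \<in> le_L T \<longleftrightarrow> x \<in> T \<and> y \<in> T \<and> (\<exists>a\<in>T. x = a * y)"
    using True unfolding le_L_def adjoin_identity_def by (auto simp: split_option_ex)
  moreover have "(\<exists>a\<in>T. x = a * y)" if "x = y" "y \<in> T"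
    using that e by metis
  ultimately show ?thesis by blast
next
  case False
  then show ?thesis unfolding le_L_def adjoin_identity_def by (auto simp: split_option_ex)
qed

lemma le_J_iff:
  "(x, y) \<in> le_J T \<longleftrightarrow> x \<in> T \<and> y \<in> T \<and>
     (x = y \<or> (\<exists>a\<in>T. x = a * y) \<or> (\<exists>b\<in>T. x = y * b) \<or> (\<exists>a\<in>T. \<exists>b\<in>T. x = a * y * b))"
    (is "?le \<longleftrightarrow> x \<in> T \<and> y \<in> T \<and> ?cases")
proof (cases "has_identity T")
  case True
  then obtain e where e: "e \<in> T" "\<And>z. z \<in> T \<Longrightarrow> e * z = z \<and> z * e = z"
    unfolding has_identity_def by blast
  have le: "?le \<longleftrightarrow> x \<in> T \<and> y \<in> T \<and> (\<exists>a\<in>T. \<exists>b\<in>T. x = a * y * b)"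
    using True unfolding le_J_def adjoin_identity_def by (auto simp: split_option_ex)
  have "\<exists>a\<in>T. \<exists>b\<in>T. x = a * y * b" if "x \<in> T" "y \<in> T" ?cases
  proof -
    have xe: "x * e = x" and ey: "e * y = y" using e(2) that by auto
    have "x = e * y * b" if "x = y * b" for b using that ey by simp
    moreover have "x = a * y * e" if "x = a * y" for a using that xe by simp
    moreover have "x = e * y * e" if "x = y" using that xe ey by simp
    ultimately show ?thesis using that(3) e(1) by blast
  qed
  then show ?thesis using le by blast
next
  case False
  then show ?thesis unfolding le_J_def adjoin_identity_def by (auto simp: split_option_ex)
qed

lemma le_J_mult_left:
  assumes "subsemigroup T" "(v, w) \<in> le_J T" "a \<in> T"
  shows "(a * v, w) \<in> le_J T"
proof -
  have T: "v \<in> T" "w \<in> T" using assms(2) by (simp_all add: le_J_iff)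
  have closed: "a * c \<in> T" if "c \<in> T" for c
    using assms(1,3) that unfolding subsemigroup_def by blast
  from assms(2) consider "a * v = a * w" | c where "c \<in> T" "a * v = (a * c) * w"
    | d where "d \<in> T" "a * v = a * w * d"
    | c d where "c \<in> T" "d \<in> T" "a * v = (a * c) * w * d"
    unfolding le_J_iff mult.assoc by blast
  then show ?thesis
    by cases (use closed assms(3) T in \<open>unfold le_J_iff, blast+\<close>)
qed

lemma le_J_mult_rightD:
  assumes "subsemigroup T" "(u, w * b) \<in> le_J T" "b \<in> T" "w \<in> T"
  shows "(u, w) \<in> le_J T"
proof -
  have T: "u \<in> T" using assms(2) by (simp add: le_J_iff)
  have closed: "b * d \<in> T" if "d \<in> T" for d
    using assms(1,3) that unfolding subsemigroup_def by blast
  from assms(2) consider "u = w * b" | c where "c \<in> T" "u = c * w * b"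
    | d where "d \<in> T" "u = w * (b * d)"
    | c d where "c \<in> T" "d \<in> T" "u = c * w * (b * d)"
    unfolding le_J_iff mult.assoc by blast
  then show ?thesis
    by cases (use closed assms(3,4) T in \<open>unfold le_J_iff, blast+\<close>)
qed

text \<open>If \<open>y = y z y\<close>, then \<open>y = (y z) y (z y)\<close>, which supplies any missing multiplier.\<close>

lemma le_J_regularE:
  assumes "subsemigroup U" "regular_semigroup U" "(x, y) \<in> le_J U"
  obtains a b where "a \<in> U" "b \<in> U" "x = a * y * b"
proof -
  have y: "y \<in> U" using assms(3) by (simp add: le_J_iff)
  then obtain z where z: "z \<in> U" "y = y * z * y"
    using assms(2) unfolding regular_semigroup_def by blast
  have l: "y * z \<in> U" and r: "z * y \<in> U"
    using assms(1) y z(1) unfolding subsemigroup_def by auto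
  have yl: "y * z * y = y" and yr: "y * (z * y) = y"
    using z(2) by (simp_all add: mult.assoc)
  from assms(3) consider "x = y" | a where "a \<in> U" "x = a * y" | b where "b \<in> U" "x = y * b"
    | a b where "a \<in> U" "b \<in> U" "x = a * y * b"
    unfolding le_J_iff by blast
  then show thesis
  proof cases
    case 1
    then show thesis using that[OF l r] by (simp add: yl yr)
  next
    case (2 a)
    then show thesis using that[OF _ r] by (simp add: mult.assoc yr)
  next
    case (3 b)
    then show thesis using that[OF l] by (simp add: yl)
  next
    case 4
    then show thesis by (rule that)
  qed
qed

text \<open>
  If \<open>u = s v\<close> with \<open>s\<close> possibly outside \<open>U\<close>, then \<open>v = v z v\<close> gives \<open>u = s v z v = (u z) v\<close>, and
  \<open>u z\<close> is a multiplier in \<open>U\<close>.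
\<close>

lemma le_L_restrict_regular:
  assumes "subsemigroup U" "regular_semigroup U" "u \<in> U" "v \<in> U" "(u, v) \<in> le_L T"
  shows "(u, v) \<in> le_L U"
proof -
  obtain z where z: "z \<in> U" "v = v * z * v"
    using assms(2,4) unfolding regular_semigroup_def by blast
  have "u * z \<in> U" using assms(1,3) z(1) unfolding subsemigroup_def by blast
  moreover have "u = u * z * v" if "u = s * v" for s
    using that z(2) by (metis mult.assoc)
  ultimately show ?thesis using assms(3-5) unfolding le_L_iff by blast
qed

lemma le_R_restrict_regular:
  assumes "subsemigroup U" "regular_semigroup U" "u \<in> U" "v \<in> U" "(u, v) \<in> le_R T"
  shows "(u, v) \<in> le_R U"
proof -
  obtain z where z: "z \<in> U" "v = v * z * v"
    using assms(2,4) unfolding regular_semigroup_def by blast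
  have "z * u \<in> U" using assms(1,3) z(1) unfolding subsemigroup_def by blast
  moreover have "u = v * (z * u)" if "u = v * t" for t
    using that z(2) by (metis mult.assoc)
  ultimately show ?thesis using assms(3-5) unfolding le_R_iff by blast
qed

theorem corollary9:
  fixes U :: "'a::semigroup_mult set" and x y :: 'a
  assumes "stable_semigroup (UNIV :: 'a set)"
    and "subsemigroup U" and "regular_semigroup U"
    and "x \<in> U" and "y \<in> U"
    and "(x, y) \<in> green_J UNIV"
    and "(x, y) \<in> le_J U"
  shows "(x, y) \<in> green_D U"
proof -
  obtain a b where ab: "a \<in> U" "b \<in> U" "x = a * y * b"
    using le_J_regularE assms(2,3,7) .
  have ay: "a * y \<in> U" using assms(2,5) ab(1) unfolding subsemigroup_def by blast
  have S: "subsemigroup (UNIV :: 'a set)" by (simp add: subsemigroup_def)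
  have yx: "(y, a * y * b) \<in> le_J UNIV"
    using assms(6) ab(3) by (simp add: green_J_def)
  have "(y, a * y) \<in> green_J UNIV"
    using le_J_mult_rightD[OF S yx] by (auto simp: green_J_def le_J_iff)
  then have L: "(y, a * y) \<in> green_L UNIV"
    using assms(1) by (simp add: stable_semigroup_def left_stable_def)
  have "(a * y, a * y * b) \<in> green_J UNIV"
    using le_J_mult_left[OF S yx, of a] by (auto simp: green_J_def le_J_iff)
  then have R: "(a * y, x) \<in> green_R UNIV"
    using assms(1) ab(3) by (simp add: stable_semigroup_def right_stable_def)
  have "(x, a * y) \<in> green_R U"
    using R le_R_restrict_regular[OF assms(2,3)] assms(4) ay by (auto simp: green_R_def)
  moreover have "(a * y, y) \<in> green_L U"
    using L le_L_restrict_regular[OF assms(2,3)] assms(5) ay by (auto simp: green_L_def)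
  ultimately show ?thesis unfolding green_D_def by blast
qed

end
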